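(* Let $K$ be a field. Every monomial ideal of intersection type in $K[x_1,\ldots,x_n]$ is integrally closed.
   Context: A monomial prime ideal is a prime ideal generated by a subset of the variables. A monomial ideal of $S=K[x_1,\ldots,x_n]$ is of intersection type if it is an intersection of powers (with positive integer exponents; the empty intersection is $S$) of monomial prime ideals. *)

theory Defs
  imports
    "HOL-Library.Poly_Mapping"
    "HOL-Algebra.Ideal_Product"
    "HOL-Algebra.Algebraic_Closure_Type"
begin

text \<open>
  The polynomial ring \<open>S = K[x\<^sub>1, \<dots>, x\<^sub>n]\<close>: the variables are indexed by a finite type
  \<open>'n\<close> (so \<open>n = CARD('n)\<close>), an exponent vector is an element of \<open>'n \<Rightarrow>\<^sub>0 nat\<close>, and a polynomial
  is a finitely supported map from exponent vectors to coefficients.  All elements of the type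
  are polynomials, so the carrier of the ring record is \<open>UNIV\<close>.
\<close>

type_synonym ('n, 'k) mpoly = "('n \<Rightarrow>\<^sub>0 nat) \<Rightarrow>\<^sub>0 'k"

abbreviation mpoly_ring :: "('n::finite, 'k::field) mpoly ring"
  where "mpoly_ring \<equiv> ring_of_type_algebra"

definition mmonom :: "('n::finite \<Rightarrow>\<^sub>0 nat) \<Rightarrow> ('n, 'k::field) mpoly"
  where "mmonom m = Poly_Mapping.single m 1"

definition mvar :: "'n::finite \<Rightarrow> ('n, 'k::field) mpoly"
  where "mvar i = mmonom (Poly_Mapping.single i 1)"

definition ideal_power :: "('a, 'b) ring_scheme \<Rightarrow> 'a set \<Rightarrow> nat \<Rightarrow> 'a set"
  where "ideal_power R I d = I [^]\<^bsub>ideals_set R\<^esub> d"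

definition monomial_ideal :: "('n::finite, 'k::field) mpoly set \<Rightarrow> bool"
  where "monomial_ideal I \<longleftrightarrow> (\<exists>M. I = Idl\<^bsub>mpoly_ring\<^esub> (mmonom ` M))"

definition monomial_prime_ideal :: "('n::finite, 'k::field) mpoly set \<Rightarrow> bool"
  where "monomial_prime_ideal P \<longleftrightarrow>
    primeideal P mpoly_ring \<and> (\<exists>A. P = Idl\<^bsub>mpoly_ring\<^esub> (mvar ` A))"

text \<open>
  The index set \<open>F\<close> consists of pairs of a monomial prime ideal and an exponent.  It may be
  empty, giving \<open>I = UNIV\<close>, which is the whole ring.  Finiteness of \<open>F\<close> is not required; infinite
  families give no further ideals, since infinitely many powers of one monomial prime ideal
  intersect in the zero ideal, the monomial prime ideal of the empty set of variables.
\<close>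

definition intersection_type :: "('n::finite, 'k::field) mpoly set \<Rightarrow> bool"
  where "intersection_type I \<longleftrightarrow> monomial_ideal I \<and>
    (\<exists>F. (\<forall>(P, d) \<in> F. monomial_prime_ideal P \<and> d \<ge> 1) \<and>
         I = (\<Inter>(P, d) \<in> F. ideal_power mpoly_ring P d))"

text \<open>
  An element \<open>f\<close> is integral over the ideal \<open>I\<close> if it satisfies an equation
  \<open>f\<^sup>k + a\<^sub>1 f\<^sup>k\<^sup>-\<^sup>1 + \<dots> + a\<^sub>k = 0\<close> with \<open>k \<ge> 1\<close> and each \<open>a\<^sub>i\<close> in the \<open>i\<close>-th power of \<open>I\<close>.
\<close>

definition integral_over_ideal :: "('a, 'b) ring_scheme \<Rightarrow> 'a set \<Rightarrow> 'a \<Rightarrow> bool"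
  where "integral_over_ideal R I f \<longleftrightarrow>
    (\<exists>k\<ge>1. \<exists>a. (\<forall>i\<in>{1..k}. a i \<in> ideal_power R I i) \<and>
       f [^]\<^bsub>R\<^esub> k \<oplus>\<^bsub>R\<^esub> (\<Oplus>\<^bsub>R\<^esub>i\<in>{1..k}. a i \<otimes>\<^bsub>R\<^esub> f [^]\<^bsub>R\<^esub> (k - i)) = \<zero>\<^bsub>R\<^esub>)"

definition ideal_integral_closure :: "('a, 'b) ring_scheme \<Rightarrow> 'a set \<Rightarrow> 'a set"
  where "ideal_integral_closure R I = {f \<in> carrier R. integral_over_ideal R I f}"

definition integrally_closed_ideal :: "('a, 'b) ring_scheme \<Rightarrow> 'a set \<Rightarrow> bool"
  where "integrally_closed_ideal R I \<longleftrightarrow> ideal I R \<and> ideal_integral_closure R I = I"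

end

theory Submission
  imports Defs "HOL-Computational_Algebra.Polynomial"
begin

text \<open>
  The reason is valuative.  Give each variable a natural number as its weight.  The polynomials
  all of whose monomials have weight at least \<open>d\<close> form an ideal, and these ideals for varying \<open>d\<close>
  are a filtration that comes from a valuation: the least weight of a monomial is additive
  under multiplication.  If \<open>f\<close> had a monomial of weight \<open>e < d\<close> with \<open>e\<close> minimal, then \<open>f\<^sup>k\<close>
  would contain a monomial of weight \<open>k e\<close>, while each term \<open>a\<^sub>i f\<^sup>k\<^sup>-\<^sup>i\<close> with \<open>a\<^sub>i\<close> of weight at
  least \<open>i d\<close> has weight at least \<open>i d + (k - i) e > k e\<close>.  So no integral equation over the
  \<open>d\<close>-th step of the filtration is possible, and that step is integrally closed
  (\<open>weight_filtration_integral\<close>).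

  The \<open>d\<close>-th power of the monomial prime ideal of a set \<open>A\<close> of variables is the \<open>d\<close>-th step of
  the filtration in which the variables in \<open>A\<close> have weight \<open>1\<close> and the others weight \<open>0\<close>
  (\<open>ideal_power_variables\<close>).  An element integral over an intersection of such powers is integral
  over each of them, hence lies in each of them.

  Additivity of the least weight rests on the absence of cancellation at an extremal monomial.
  Several monomials of \<open>f\<close> may share the least weight, so the weight is perturbed to a weight that
  attains its minimum on the monomials of \<open>f\<close> only once (\<open>strict_minimizer_exists\<close>); the monomial
  where this happens cannot cancel in a power of \<open>f\<close> (\<open>isolated_monomial_mult\<close>).
\<close>

section \<open>Weights of monomials\<close>

definition weight :: "('n::finite \<Rightarrow> nat) \<Rightarrow> ('n \<Rightarrow>\<^sub>0 nat) \<Rightarrow> nat"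
  where "weight u m = (\<Sum>i\<in>UNIV. u i * Poly_Mapping.lookup m i)"

lemma weight_zero [simp]: "weight u 0 = 0"
  by (simp add: weight_def)

lemma weight_add: "weight u (m + m') = weight u m + weight u m'"
  by (simp add: weight_def lookup_add distrib_left sum.distrib)

lemma weight_single: "weight u (Poly_Mapping.single i c) = u i * c"
proof -
  have "weight u (Poly_Mapping.single i c) = (\<Sum>j\<in>UNIV. if j = i then u i * c else 0)"
    unfolding weight_def by (rule sum.cong) (auto simp: lookup_single)
  then show ?thesis by simp
qed

lemma weight_linear: "weight (\<lambda>i. C * u i + w i) m = C * weight u m + weight w m"
  by (simp add: weight_def sum.distrib sum_distrib_left algebra_simps)

text \<open>
  With the weights \<open>t ^ j i\<close> for distinct exponents \<open>j i\<close>, two different monomials have the same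
  weight only if \<open>t\<close> is a root of a nonzero integer polynomial.  Finitely many monomials exclude
  only finitely many \<open>t\<close>.
\<close>

lemma separating_weight_exists:
  fixes S :: "('n::finite \<Rightarrow>\<^sub>0 nat) set"
  assumes "finite S"
  shows "\<exists>w. inj_on (weight w) S"
proof -
  obtain j :: "'n \<Rightarrow> nat" where j: "inj j"
    using finite_imp_inj_to_nat_seg[of "UNIV :: 'n set"] by auto
  define p :: "('n \<Rightarrow>\<^sub>0 nat) \<Rightarrow> int poly"
    where "p m = (\<Sum>i\<in>UNIV. monom (int (Poly_Mapping.lookup m i)) (j i))" for m
  have poly_p: "poly (p m) (int t) = int (weight (\<lambda>i. t ^ j i) m)" for m t
    by (simp add: p_def weight_def poly_sum poly_monom mult.commute)
  have coeff_p: "coeff (p m) (j i) = int (Poly_Mapping.lookup m i)" for m i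
  proof -
    have "coeff (p m) (j i) =
        (\<Sum>i'\<in>UNIV. if i' = i then int (Poly_Mapping.lookup m i') else 0)"
      unfolding p_def coeff_sum by (rule sum.cong) (auto simp: j[THEN inj_eq])
    then show ?thesis by simp
  qed
  have p_inj: "p m \<noteq> p m'" if "m \<noteq> m'" for m m'
    using that coeff_p by (metis of_nat_eq_iff poly_mapping_eqI)
  define Z where "Z = (\<Union>m\<in>S. \<Union>m'\<in>S - {m}. {x. poly (p m - p m') x = 0})"
  have "finite Z"
    unfolding Z_def using assms p_inj by (intro finite_UN_I finite_Diff poly_roots_finite) auto
  then have "finite (int -` Z)"
    by (rule finite_vimageI) simp
  then obtain t where "int t \<notin> Z"
    using infinite_UNIV_nat by (metis UNIV_eq_I vimageI)
  then have "inj_on (weight (\<lambda>i. t ^ j i)) S"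
    by (auto simp: Z_def inj_on_def poly_p)
  then show ?thesis by blast
qed

text \<open>
  A weight \<open>w\<close> separating the points of \<open>S\<close> breaks the ties of \<open>u\<close>.  Scaling \<open>u\<close> by a constant
  above all values of \<open>w\<close> on \<open>S\<close> turns the lexicographic comparison by \<open>u\<close>, then \<open>w\<close>, into
  comparison by a single weight.
\<close>

lemma strict_minimizer_exists:
  fixes S :: "('n::finite \<Rightarrow>\<^sub>0 nat) set"
  assumes "finite S" "S \<noteq> {}"
  shows "\<exists>m0\<in>S. \<exists>v. (\<forall>m\<in>S - {m0}. weight v m0 < weight v m) \<and>
           (\<forall>m\<in>S. weight u m0 \<le> weight u m)"
proof -
  obtain w where w: "inj_on (weight w) S"
    using separating_weight_exists[OF assms(1)] by blast
  define C where "C = Suc (Max (weight w ` S))"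
  have C: "weight w m < C" if "m \<in> S" for m
    using that assms(1) by (simp add: C_def less_Suc_eq_le)
  define v where "v = (\<lambda>i. C * u i + w i)"
  have v: "weight v m = C * weight u m + weight w m" for m
    unfolding v_def by (rule weight_linear)
  have inj: "inj_on (weight v) S"
  proof (rule inj_onI)
    fix m m' assume m: "m \<in> S" "m' \<in> S" and eq: "weight v m = weight v m'"
    have "weight w m = weight v m mod C" "weight w m' = weight v m' mod C"
      using C m by (simp_all add: v)
    with eq m w show "m = m'" by (simp add: inj_on_def)
  qed
  obtain m0 where m0: "m0 \<in> S" "\<And>m. m \<in> S \<Longrightarrow> weight v m0 \<le> weight v m"
    using ex_min_if_finite[of "weight v ` S"] assms by (auto simp: not_less)
  have "weight v m0 < weight v m" if "m \<in> S - {m0}" for m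
    using that m0 inj by (metis DiffD1 DiffD2 inj_onD insertI1 le_neq_implies_less)
  moreover have "weight u m0 \<le> weight u m" if m: "m \<in> S" for m
  proof (rule ccontr)
    assume "\<not> weight u m0 \<le> weight u m"
    then have "C * Suc (weight u m) \<le> C * weight u m0"
      by (intro mult_le_mono2) simp
    moreover have "weight v m < C * Suc (weight u m)"
      using C[OF m] by (simp add: v)
    ultimately have "weight v m < weight v m0"
      by (simp add: v)
    with m0(2)[OF m] show False by simp
  qed
  ultimately show ?thesis using m0(1) by blast
qed

section \<open>Weight filtrations\<close>

definition weight_filtration :: "('n::finite \<Rightarrow> nat) \<Rightarrow> nat \<Rightarrow> ('n, 'k::field) mpoly set"
  where "weight_filtration u d = {f. \<forall>m\<in>Poly_Mapping.keys f. d \<le> weight u m}"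

lemma weight_filtration_zero [simp]: "weight_filtration u 0 = UNIV"
  by (simp add: weight_filtration_def)

lemma zero_in_weight_filtration: "0 \<in> weight_filtration u d"
  by (simp add: weight_filtration_def)

lemma weight_filtration_add:
  "f \<in> weight_filtration u d \<Longrightarrow> g \<in> weight_filtration u d \<Longrightarrow> f + g \<in> weight_filtration u d"
  using keys_add[of f g] by (auto simp: weight_filtration_def)

lemma weight_filtration_uminus:
  "f \<in> weight_filtration u d \<Longrightarrow> - f \<in> weight_filtration u d"
  by (auto simp: weight_filtration_def in_keys_iff)

lemma weight_filtration_mult:
  assumes "f \<in> weight_filtration u d" "g \<in> weight_filtration u e"
  shows "f * g \<in> weight_filtration u (d + e)"
  using assms keys_mult[of f g] by (fastforce simp: weight_filtration_def weight_add add_mono)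

lemma weight_filtration_mult_left:
  "f \<in> weight_filtration u d \<Longrightarrow> g * f \<in> weight_filtration u d"
  using weight_filtration_mult[of g u 0 f d] by simp

lemma weight_filtration_sum:
  "(\<And>i. i \<in> B \<Longrightarrow> g i \<in> weight_filtration u d) \<Longrightarrow> sum g B \<in> weight_filtration u d"
  by (induction B rule: infinite_finite_induct)
     (simp_all add: zero_in_weight_filtration weight_filtration_add)

lemma weight_filtration_power:
  "f \<in> weight_filtration u d \<Longrightarrow> f ^ k \<in> weight_filtration u (k * d)"
  by (induction k) (auto intro: weight_filtration_mult)

lemma weight_filtration_antimono:
  "e \<le> d \<Longrightarrow> weight_filtration u d \<subseteq> weight_filtration u e"
  by (auto simp: weight_filtration_def)

section \<open>Extremal monomials do not cancel\<close>

definition isolated_monomial ::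
    "('n::finite \<Rightarrow> nat) \<Rightarrow> ('n \<Rightarrow>\<^sub>0 nat) \<Rightarrow> ('n, 'k::field) mpoly \<Rightarrow> bool"
  where "isolated_monomial v m f \<longleftrightarrow>
    m \<in> Poly_Mapping.keys f \<and> (\<forall>m'\<in>Poly_Mapping.keys f - {m}. weight v m < weight v m')"

lemma isolated_monomial_iff:
  "isolated_monomial v m f \<longleftrightarrow>
    (\<exists>c r. c \<noteq> 0 \<and> f = Poly_Mapping.single m c + r \<and> r \<in> weight_filtration v (Suc (weight v m)))"
proof
  assume iso: "isolated_monomial v m f"
  define r where "r = f - Poly_Mapping.single m (Poly_Mapping.lookup f m)"
  have "m' \<in> Poly_Mapping.keys f - {m}" if "m' \<in> Poly_Mapping.keys r" for m'
    using that by (cases "m' = m") (auto simp: r_def in_keys_iff lookup_minus lookup_single)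
  with iso have "r \<in> weight_filtration v (Suc (weight v m))"
    by (auto simp: isolated_monomial_def weight_filtration_def Suc_le_eq)
  moreover have "Poly_Mapping.lookup f m \<noteq> 0"
    using iso by (simp add: isolated_monomial_def in_keys_iff)
  moreover have "f = Poly_Mapping.single m (Poly_Mapping.lookup f m) + r"
    by (simp add: r_def)
  ultimately show "\<exists>c r. c \<noteq> 0 \<and> f = Poly_Mapping.single m c + r \<and>
      r \<in> weight_filtration v (Suc (weight v m))" by blast
next
  assume "\<exists>c r. c \<noteq> 0 \<and> f = Poly_Mapping.single m c + r \<and>
      r \<in> weight_filtration v (Suc (weight v m))"
  then obtain c r where c: "c \<noteq> 0" and f: "f = Poly_Mapping.single m c + r"
    and r: "r \<in> weight_filtration v (Suc (weight v m))" by blast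
  have "m \<notin> Poly_Mapping.keys r"
    using r by (auto simp: weight_filtration_def)
  then have "Poly_Mapping.lookup r m = 0"
    by (simp add: in_keys_iff)
  then have "m \<in> Poly_Mapping.keys f"
    using c by (simp add: f in_keys_iff lookup_add)
  moreover have "m' \<in> Poly_Mapping.keys r" if "m' \<in> Poly_Mapping.keys f - {m}" for m'
    using that by (auto simp: f in_keys_iff lookup_add lookup_single when_def)
  ultimately show "isolated_monomial v m f"
    using r by (auto simp: isolated_monomial_def weight_filtration_def Suc_le_eq)
qed

text \<open>
  The product of the two leading terms is the only contribution of weight at most that of
  \<open>m + m'\<close>, and its coefficient is nonzero because the coefficients form a field.
\<close>

lemma isolated_monomial_mult:
  assumes "isolated_monomial v m f" "isolated_monomial v m' g"
  shows "isolated_monomial v (m + m') (f * g)"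
proof -
  obtain c r where c: "c \<noteq> 0" and f: "f = Poly_Mapping.single m c + r"
    and r: "r \<in> weight_filtration v (Suc (weight v m))"
    using assms(1) by (auto simp: isolated_monomial_iff)
  obtain c' r' where c': "c' \<noteq> 0" and g: "g = Poly_Mapping.single m' c' + r'"
    and r': "r' \<in> weight_filtration v (Suc (weight v m'))"
    using assms(2) by (auto simp: isolated_monomial_iff)
  have lead: "Poly_Mapping.single m c \<in> weight_filtration v (weight v m)"
    by (simp add: weight_filtration_def)
  have "weight v m' \<le> weight v q" if "q \<in> Poly_Mapping.keys g" for q
    using that assms(2) by (cases "q = m'") (auto simp: isolated_monomial_def less_imp_le)
  then have g_in: "g \<in> weight_filtration v (weight v m')"
    by (simp add: weight_filtration_def)
  have "Poly_Mapping.single m c * r' + r * g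
      \<in> weight_filtration v (Suc (weight v (m + m')))"
    using weight_filtration_mult[OF lead r'] weight_filtration_mult[OF r g_in]
    by (intro weight_filtration_add) (simp_all add: weight_add)
  moreover have "f * g = Poly_Mapping.single (m + m') (c * c')
      + (Poly_Mapping.single m c * r' + r * g)"
    by (simp add: f g mult_single algebra_simps)
  ultimately show ?thesis
    using c c' unfolding isolated_monomial_iff by (metis mult_eq_0_iff)
qed

lemma isolated_monomial_power:
  assumes "isolated_monomial v m f"
  shows "\<exists>m'. isolated_monomial v m' (f ^ k) \<and> weight u m' = k * weight u m"
proof (induction k)
  case 0
  show ?case by (intro exI[of _ 0]) (simp add: isolated_monomial_def)
next
  case (Suc k)
  then obtain m' where "isolated_monomial v m' (f ^ k)" "weight u m' = k * weight u m" by blast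
  with assms show ?case
    by (intro exI[of _ "m + m'"]) (simp add: isolated_monomial_mult weight_add)
qed

text \<open>
  The monomial \<open>m0\<close> has the least weight \<open>e\<close> for \<open>u\<close> and is isolated for a perturbed weight \<open>v\<close>.
  Isolation for \<open>v\<close> keeps its \<open>k\<close>-th power in \<open>f ^ k\<close>, where \<open>u\<close> gives it the weight \<open>k * e\<close>;
  if \<open>e < d\<close>, every other term of the equation consists of monomials of greater weight for \<open>u\<close>.
\<close>

theorem weight_filtration_integral:
  fixes f :: "('n::finite, 'k::field) mpoly"
  assumes eq: "f ^ k + (\<Sum>i=1..k. a i * f ^ (k - i)) = 0"
    and a: "\<And>i. i \<in> {1..k} \<Longrightarrow> a i \<in> weight_filtration u (i * d)"
  shows "f \<in> weight_filtration u d"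
proof (rule ccontr)
  assume "f \<notin> weight_filtration u d"
  then obtain m1 where m1: "m1 \<in> Poly_Mapping.keys f" "weight u m1 < d"
    by (auto simp: weight_filtration_def not_le)
  then obtain m0 v where m0: "m0 \<in> Poly_Mapping.keys f"
    and strict: "\<forall>m\<in>Poly_Mapping.keys f - {m0}. weight v m0 < weight v m"
    and least: "\<forall>m\<in>Poly_Mapping.keys f. weight u m0 \<le> weight u m"
    using strict_minimizer_exists[OF finite_keys, of f u] by blast
  define e where "e = weight u m0"
  have "e < d" using least m1 by (auto simp: e_def)
  have f_in: "f \<in> weight_filtration u e"
    using least by (simp add: weight_filtration_def e_def)
  have "a i * f ^ (k - i) \<in> weight_filtration u (Suc (k * e))" if i: "i \<in> {1..k}" for i
  proof -
    have "k * e = i * e + (k - i) * e"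
      using i by (simp flip: add_mult_distrib)
    moreover have "i * e < i * d"
      using i \<open>e < d\<close> by simp
    ultimately have "Suc (k * e) \<le> i * d + (k - i) * e" by linarith
    then show ?thesis
      using weight_filtration_mult[OF a[OF i] weight_filtration_power[OF f_in]]
        weight_filtration_antimono by blast
  qed
  then have "(\<Sum>i=1..k. a i * f ^ (k - i)) \<in> weight_filtration u (Suc (k * e))"
    by (rule weight_filtration_sum)
  moreover have "f ^ k = - (\<Sum>i=1..k. a i * f ^ (k - i))"
    using eq by (simp add: eq_neg_iff_add_eq_0)
  ultimately have "f ^ k \<in> weight_filtration u (Suc (k * e))"
    by (simp add: weight_filtration_uminus)
  moreover obtain m where "m \<in> Poly_Mapping.keys (f ^ k)" "weight u m = k * e"
    using isolated_monomial_power[of v m0 f k u] m0 strict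
    by (auto simp: isolated_monomial_def e_def)
  ultimately show False
    by (auto simp: weight_filtration_def)
qed

section \<open>The ring record on a type\<close>

lemma ring_of_type_algebra_simps:
  "carrier ring_of_type_algebra = UNIV"
  "x \<otimes>\<^bsub>ring_of_type_algebra\<^esub> y = x * y"
  "x \<oplus>\<^bsub>ring_of_type_algebra\<^esub> y = x + y"
  "\<one>\<^bsub>ring_of_type_algebra\<^esub> = 1"
  "\<zero>\<^bsub>ring_of_type_algebra\<^esub> = 0"
  by (simp_all add: ring_of_type_algebra_def)

lemma nat_pow_ring_of_type_algebra:
  "(x :: 'a::comm_ring_1) [^]\<^bsub>ring_of_type_algebra\<^esub> (k::nat) = x ^ k"
  by (induction k) (simp_all add: nat_pow_def ring_of_type_algebra_simps mult.commute)

lemma finsum_ring_of_type_algebra: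
  fixes g :: "'i \<Rightarrow> 'a::comm_ring_1"
  assumes "finite B"
  shows "finsum ring_of_type_algebra g B = sum g B"
proof -
  interpret cring "ring_of_type_algebra :: 'a ring" by (rule cring_from_type_algebra)
  from assms show ?thesis
    by (induction B) (simp_all add: ring_of_type_algebra_simps)
qed

lemma ideal_ring_of_type_algebraI:
  fixes I :: "'a::comm_ring_1 set"
  assumes "0 \<in> I" "\<And>x y. x \<in> I \<Longrightarrow> y \<in> I \<Longrightarrow> x + y \<in> I" "\<And>r x. x \<in> I \<Longrightarrow> r * x \<in> I"
  shows "ideal I ring_of_type_algebra"
proof -
  interpret cring "ring_of_type_algebra :: 'a ring" by (rule cring_from_type_algebra)
  have minus: "inv\<^bsub>add_monoid ring_of_type_algebra\<^esub> x = - x" for x :: 'a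
    unfolding a_inv_def[symmetric]
    by (rule minus_equality) (simp_all add: ring_of_type_algebra_simps)
  show ?thesis
  proof (rule idealI[OF ring_axioms])
    show "subgroup I (add_monoid (ring_of_type_algebra :: 'a ring))"
      using assms(1,2) assms(3)[of _ "- 1"]
      unfolding subgroup_def minus by (auto simp: ring_of_type_algebra_simps)
  qed (use assms(3) in \<open>auto simp: ring_of_type_algebra_simps mult.commute\<close>)
qed

lemma ideal_ring_of_type_algebraD:
  fixes I :: "'a::comm_ring_1 set"
  assumes "ideal I ring_of_type_algebra"
  shows "0 \<in> I" "\<And>x y. x \<in> I \<Longrightarrow> y \<in> I \<Longrightarrow> x + y \<in> I" "\<And>r x. x \<in> I \<Longrightarrow> r * x \<in> I"
proof -
  interpret ideal I "ring_of_type_algebra :: 'a ring" by (rule assms)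
  show "0 \<in> I" "\<And>x y. x \<in> I \<Longrightarrow> y \<in> I \<Longrightarrow> x + y \<in> I" "\<And>r x. x \<in> I \<Longrightarrow> r * x \<in> I"
    using additive_subgroup.zero_closed[OF is_additive_subgroup]
      additive_subgroup.a_closed[OF is_additive_subgroup] I_l_closed
    by (simp_all add: ring_of_type_algebra_simps)
qed

lemma ideal_sum_closed:
  fixes I :: "'a::comm_ring_1 set"
  assumes "ideal I ring_of_type_algebra" "\<And>i. i \<in> B \<Longrightarrow> g i \<in> I"
  shows "sum g B \<in> I"
  using assms(2)
  by (induction B rule: infinite_finite_induct) (simp_all add: ideal_ring_of_type_algebraD[OF assms(1)])

lemma ideal_power_0 [simp]: "ideal_power R I 0 = carrier R"
  by (simp add: ideal_power_def nat_pow_def ideals_set_def)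

lemma ideal_power_Suc [simp]: "ideal_power R I (Suc k) = ideal_prod R (ideal_power R I k) I"
  by (simp add: ideal_power_def nat_pow_def ideals_set_def)

lemma ideal_power_is_ideal:
  assumes "ideal I R"
  shows "ideal (ideal_power R I k) R"
proof -
  interpret ideal I R by (rule assms)
  show ?thesis
    by (induction k) (simp_all add: oneideal ideal_prod_is_ideal assms)
qed

lemma ideal_power_one:
  assumes "cring R" "ideal I R"
  shows "ideal_power R I 1 = I"
proof -
  interpret cring R by (rule assms)
  show ?thesis
    using ideal_prod_commute[OF oneideal assms(2)] ideal_prod_one[OF assms(2)] by simp
qed

section \<open>Powers of monomial prime ideals\<close>

lemma weight_filtration_is_ideal: "ideal (weight_filtration u d) mpoly_ring"
  by (intro ideal_ring_of_type_algebraI zero_in_weight_filtration weight_filtration_add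
      weight_filtration_mult_left)

lemma ideal_power_subset_weight_filtration:
  assumes "I \<subseteq> weight_filtration u d"
  shows "ideal_power mpoly_ring I k \<subseteq> weight_filtration u (k * d)"
proof (induction k)
  case (Suc k)
  have "f \<in> weight_filtration u (Suc k * d)"
    if "f \<in> ideal_prod mpoly_ring (ideal_power mpoly_ring I k) I" for f
    using that
  proof induction
    case (prod g h)
    then show ?case
      using weight_filtration_mult[of g u "k * d" h d] Suc.IH assms
      by (auto simp: ring_of_type_algebra_simps add.commute)
  next
    case (sum g h)
    then show ?case
      by (simp add: ring_of_type_algebra_simps weight_filtration_add)
  qed
  then show ?case by auto
qed simp

lemma ideal_contains_monomials:
  assumes I: "ideal I mpoly_ring" and m: "\<And>m. m \<in> Poly_Mapping.keys f \<Longrightarrow> mmonom m \<in> I"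
  shows "f \<in> I"
proof -
  have single_eq: "Poly_Mapping.single m (Poly_Mapping.lookup f m) =
      Poly_Mapping.single 0 (Poly_Mapping.lookup f m) * mmonom m" for m
    by (simp add: mmonom_def mult_single)
  have "f = (\<Sum>m\<in>Poly_Mapping.keys f. Poly_Mapping.single m (Poly_Mapping.lookup f m))"
    by (rule poly_mapping_eqI) (auto simp: lookup_sum lookup_single when_def in_keys_iff)
  also have "\<dots> \<in> I"
    unfolding single_eq using m by (intro ideal_sum_closed[OF I] ideal_ring_of_type_algebraD(3)[OF I])
  finally show ?thesis .
qed

text \<open>
  A monomial of degree more than \<open>d\<close> in the variables of \<open>A\<close> is divisible by one of these
  variables, and dividing by it lowers that degree by one.
\<close>

lemma monomial_in_ideal_power_variables:
  fixes A :: "'n::finite set"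
  assumes "d \<le> weight (\<lambda>i. of_bool (i \<in> A)) m"
  shows "mmonom m \<in>
    ideal_power mpoly_ring (Idl\<^bsub>mpoly_ring\<^esub> (mvar ` A) :: ('n, 'k::field) mpoly set) d"
    (is "_ \<in> ideal_power _ ?P d")
  using assms
proof (induction d arbitrary: m)
  case 0
  show ?case by (simp add: ring_of_type_algebra_simps)
next
  case (Suc d)
  interpret cring "mpoly_ring :: ('n, 'k) mpoly ring" by (rule cring_from_type_algebra)
  have "weight (\<lambda>i. of_bool (i \<in> A)) m \<noteq> 0"
    using Suc.prems by simp
  then obtain i where i: "i \<in> A" "Poly_Mapping.lookup m i \<noteq> 0"
    by (auto simp: weight_def)
  have split: "m = (m - Poly_Mapping.single i 1) + Poly_Mapping.single i 1"
    using i(2) by (intro poly_mapping_eqI) (auto simp: lookup_add lookup_minus lookup_single when_def)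
  have "weight (\<lambda>i. of_bool (i \<in> A)) m =
      weight (\<lambda>i. of_bool (i \<in> A)) (m - Poly_Mapping.single i 1) + 1"
    by (subst split) (simp add: weight_add weight_single i(1))
  with Suc have "mmonom (m - Poly_Mapping.single i 1)
      \<in> ideal_power mpoly_ring ?P d" by simp
  moreover have "mvar i \<in> ?P"
    using genideal_self[of "mvar ` A"] i(1) by (auto simp: ring_of_type_algebra_simps)
  ultimately have "mmonom (m - Poly_Mapping.single i 1) \<otimes>\<^bsub>mpoly_ring\<^esub> mvar i
      \<in> ideal_power mpoly_ring ?P (Suc d)"
    by (auto intro: ideal_prod.prod)
  moreover have "mmonom (m - Poly_Mapping.single i 1) \<otimes>\<^bsub>mpoly_ring\<^esub> mvar i
      = (mmonom m :: ('n, 'k) mpoly)"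
    by (subst (2) split) (simp add: ring_of_type_algebra_simps mvar_def mmonom_def mult_single)
  ultimately show ?case by (simp only:)
qed

text \<open>
  The generators have weight \<open>1\<close> and weights add, which bounds the weights in the power from below.
  Conversely the power contains every monomial of weight at least \<open>d\<close>, and these monomials span
  the filtration step.
\<close>

theorem ideal_power_variables:
  fixes A :: "'n::finite set"
  shows "ideal_power mpoly_ring (Idl\<^bsub>mpoly_ring\<^esub> (mvar ` A) :: ('n, 'k::field) mpoly set) d
    = weight_filtration (\<lambda>i. of_bool (i \<in> A)) d"
    (is "ideal_power _ ?P d = weight_filtration ?u d")
proof
  interpret cring "mpoly_ring :: ('n, 'k) mpoly ring" by (rule cring_from_type_algebra)
  have "?P \<subseteq> weight_filtration ?u 1"
    by (rule genideal_minimal[OF weight_filtration_is_ideal])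
       (auto simp: weight_filtration_def mvar_def mmonom_def weight_single)
  from ideal_power_subset_weight_filtration[OF this, of d]
  show "ideal_power mpoly_ring ?P d \<subseteq> weight_filtration ?u d" by simp
  have "ideal (ideal_power mpoly_ring ?P d) mpoly_ring"
    by (intro ideal_power_is_ideal genideal_ideal) (simp add: ring_of_type_algebra_simps)
  then show "weight_filtration ?u d \<subseteq> ideal_power mpoly_ring ?P d"
    by (auto simp: weight_filtration_def
        intro!: ideal_contains_monomials monomial_in_ideal_power_variables)
qed

section \<open>Integral closedness\<close>

text \<open>An element \<open>f\<close> of an ideal satisfies the linear equation \<open>f + (- f) = 0\<close>.\<close>

lemma ideal_subset_integral_closure:
  fixes I :: "'a::comm_ring_1 set"
  assumes I: "ideal I ring_of_type_algebra"
  shows "I \<subseteq> ideal_integral_closure ring_of_type_algebra I"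
proof
  fix f assume "f \<in> I"
  then have "- f \<in> I"
    using ideal_ring_of_type_algebraD(3)[OF I, of f "- 1"] by simp
  then have "integral_over_ideal ring_of_type_algebra I f"
    unfolding integral_over_ideal_def
    using ideal_power_one[OF cring_from_type_algebra I]
    by (intro exI[of _ "1::nat"] exI[of _ "\<lambda>_. - f"] conjI)
       (simp_all add: finsum_ring_of_type_algebra nat_pow_ring_of_type_algebra ring_of_type_algebra_simps)
  then show "f \<in> ideal_integral_closure ring_of_type_algebra I"
    by (simp add: ideal_integral_closure_def ring_of_type_algebra_simps)
qed

lemma integral_over_subset_weight_filtration:
  assumes "integral_over_ideal mpoly_ring I f" "I \<subseteq> weight_filtration u d"
  shows "f \<in> weight_filtration u d"
proof -
  obtain k a where a: "\<forall>i\<in>{1..k}. a i \<in> ideal_power mpoly_ring I i"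
    and eq: "f ^ k + (\<Sum>i=1..k. a i * f ^ (k - i)) = 0"
    using assms(1)
    by (auto simp: integral_over_ideal_def finsum_ring_of_type_algebra
        nat_pow_ring_of_type_algebra ring_of_type_algebra_simps)
  then show ?thesis
    using ideal_power_subset_weight_filtration[OF assms(2)]
    by (intro weight_filtration_integral[OF eq]) blast
qed

theorem proposition3p1:
  fixes I :: "('n::finite, 'k::field) mpoly set"
  assumes "intersection_type I"
  shows "integrally_closed_ideal mpoly_ring I"
proof -
  interpret cring "mpoly_ring :: ('n, 'k) mpoly ring" by (rule cring_from_type_algebra)
  obtain F where F: "\<forall>(P, d)\<in>F. monomial_prime_ideal P \<and> d \<ge> 1"
    and I: "I = (\<Inter>(P, d)\<in>F. ideal_power mpoly_ring P d)"
    using assms by (auto simp: intersection_type_def)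
  have ideal: "ideal I mpoly_ring"
    using assms
    by (auto simp: intersection_type_def monomial_ideal_def ring_of_type_algebra_simps
        intro!: genideal_ideal)
  have "f \<in> ideal_power mpoly_ring P d"
    if f: "integral_over_ideal mpoly_ring I f" and P: "(P, d) \<in> F" for f P d
  proof -
    obtain A where "P = Idl\<^bsub>mpoly_ring\<^esub> (mvar ` A)"
      using F P by (auto simp: monomial_prime_ideal_def)
    then have power: "ideal_power mpoly_ring P d = weight_filtration (\<lambda>i. of_bool (i \<in> A)) d"
      by (simp add: ideal_power_variables)
    have "I \<subseteq> ideal_power mpoly_ring P d"
      using I P by auto
    with integral_over_subset_weight_filtration[OF f] show ?thesis
      by (simp add: power)
  qed
  then have "ideal_integral_closure mpoly_ring I \<subseteq> I"
    by (subst (2) I) (auto simp: ideal_integral_closure_def)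
  with ideal_subset_integral_closure[OF ideal] ideal show ?thesis
    by (auto simp: integrally_closed_ideal_def)
qed

end
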